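(* For every $f:\mathcal X\times\mathcal Y\to\mathcal Z$ with $k=\lceil\log|\mathcal Z|\rceil$ and every $\epsilon>0$, $$R^{\mathrm{loc}}_\epsilon(f)\le R^{\mathrm{op}}_\epsilon(f)\le R^{\mathrm{loc}}_\epsilon(f)+k,$$ and for the Equality-with-output function, $$R^{\mathrm{loc}}_{1/4}(\mathrm{EQout}_n)\le 4,\qquad R^{\mathrm{op}}_{1/4}(\mathrm{EQout}_n)\in\Omega(n).$$
   Context: $\mathrm{EQout}_n:\{0,1\}^n\times\{0,1\}^n\to\{0,1\}^n\cup\{\top\}$ is defined by $\mathrm{EQout}_n(x,y)=x$ if $x=y$ and $\top$ otherwise. Two-party communication: Alice receives $x$, Bob $y$; they may use private randomness $r_A,r_B$ and public randomness $r$; the transcript $t_\pi$ is the sequence of exchanged bits (public randomness excluded); cost is the maximum number of bits exchanged. Open model: there is a map $O(t_\pi,r)$ with $\Pr[O(t_\pi,r)=f(x,y)]\ge1-\epsilon$ for all $(x,y)$. Local model: there are maps $O_A(t_\pi,r,r_A,x)$, $O_B(t_\pi,r,r_B,y)$ with $\Pr[O_A=O_B=f(x,y)]\ge1-\epsilon$ for all $(x,y)$. $R^{\mathrm{op}}_\epsilon,R^{\mathrm{loc}}_\epsilon$ are the minimum costs of protocols (public and private coins allowed) in these models with error at most $\epsilon$. Logarithms are base 2. *)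

theory Defs
  imports "HOL-Probability.Probability" "HOL-Library.Landau_Symbols" "HOL-Library.Extended_Nat"
begin

text \<open>
  Random strings. The distributions on them are arbitrary; as the type is countably infinite,
  every discrete source of randomness can be represented.
\<close>
type_synonym coins = "bool list"

text \<open>
  A protocol tree for a fixed value of the public randomness: the owner of a node computes the
  next bit from her or his own input and private randomness, and the bit selects the subtree.
\<close>
datatype ('x, 'y) ptree =
    Leaf
  | Alice "'x \<Rightarrow> coins \<Rightarrow> bool" "bool \<Rightarrow> ('x, 'y) ptree"
  | Bob "'y \<Rightarrow> coins \<Rightarrow> bool" "bool \<Rightarrow> ('x, 'y) ptree"

primrec run :: "('x, 'y) ptree \<Rightarrow> 'x \<Rightarrow> coins \<Rightarrow> 'y \<Rightarrow> coins \<Rightarrow> bool list" where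
  "run Leaf x a y b = []"
| "run (Alice s c) x a y b = s x a # run (c (s x a)) x a y b"
| "run (Bob s c) x a y b = s y b # run (c (s y b)) x a y b"

record ('x, 'y) protocol =
  public_coins :: "coins pmf"
  alice_coins :: "coins pmf"
  bob_coins :: "coins pmf"
  tree :: "coins \<Rightarrow> ('x, 'y) ptree"

definition coin_dist :: "('x, 'y) protocol \<Rightarrow> (coins \<times> coins \<times> coins) pmf" where
  "coin_dist \<pi> = pair_pmf (public_coins \<pi>) (pair_pmf (alice_coins \<pi>) (bob_coins \<pi>))"

definition transcript ::
  "('x, 'y) protocol \<Rightarrow> coins \<Rightarrow> coins \<Rightarrow> coins \<Rightarrow> 'x \<Rightarrow> 'y \<Rightarrow> bool list" where
  "transcript \<pi> r a b x y = run (tree \<pi> r) x a y b"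

text \<open>
  The worst case over inputs and coins; it is infinite if the number of exchanged bits is not
  bounded uniformly.
\<close>
definition cost :: "'x set \<Rightarrow> 'y set \<Rightarrow> ('x, 'y) protocol \<Rightarrow> enat" where
  "cost X Y \<pi> = (SUP ((x, y), (r, a, b)) \<in> (X \<times> Y) \<times> set_pmf (coin_dist \<pi>).
     enat (length (transcript \<pi> r a b x y)))"

text \<open>
  The output maps below may take any value of type \<open>'z\<close>; this is harmless, as a value
  outside the codomain of \<open>f\<close> is always counted as an error.
\<close>

definition computes_open ::
  "real \<Rightarrow> 'x set \<Rightarrow> 'y set \<Rightarrow> ('x \<times> 'y \<Rightarrow> 'z) \<Rightarrow> ('x, 'y) protocol \<Rightarrow> bool" where
  "computes_open \<epsilon> X Y f \<pi> \<longleftrightarrow>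
    (\<exists>out :: bool list \<Rightarrow> coins \<Rightarrow> 'z. \<forall>x\<in>X. \<forall>y\<in>Y.
      measure_pmf.prob (coin_dist \<pi>)
        {(r, a, b). out (transcript \<pi> r a b x y) r = f (x, y)} \<ge> 1 - \<epsilon>)"

definition computes_local ::
  "real \<Rightarrow> 'x set \<Rightarrow> 'y set \<Rightarrow> ('x \<times> 'y \<Rightarrow> 'z) \<Rightarrow> ('x, 'y) protocol \<Rightarrow> bool" where
  "computes_local \<epsilon> X Y f \<pi> \<longleftrightarrow>
    (\<exists>(outA :: bool list \<Rightarrow> coins \<Rightarrow> coins \<Rightarrow> 'x \<Rightarrow> 'z)
      (outB :: bool list \<Rightarrow> coins \<Rightarrow> coins \<Rightarrow> 'y \<Rightarrow> 'z). \<forall>x\<in>X. \<forall>y\<in>Y.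
      measure_pmf.prob (coin_dist \<pi>)
        {(r, a, b). outA (transcript \<pi> r a b x y) r a x = f (x, y) \<and>
                    outB (transcript \<pi> r a b x y) r b y = f (x, y)} \<ge> 1 - \<epsilon>)"

definition R_op :: "real \<Rightarrow> 'x set \<Rightarrow> 'y set \<Rightarrow> ('x \<times> 'y \<Rightarrow> 'z) \<Rightarrow> enat" where
  "R_op \<epsilon> X Y f = (INF \<pi> \<in> {\<pi>. computes_open \<epsilon> X Y f \<pi>}. cost X Y \<pi>)"

definition R_loc :: "real \<Rightarrow> 'x set \<Rightarrow> 'y set \<Rightarrow> ('x \<times> 'y \<Rightarrow> 'z) \<Rightarrow> enat" where
  "R_loc \<epsilon> X Y f = (INF \<pi> \<in> {\<pi>. computes_local \<epsilon> X Y f \<pi>}. cost X Y \<pi>)"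

definition bitstrings :: "nat \<Rightarrow> bool list set" where
  "bitstrings n = {xs. length xs = n}"

text \<open>\<open>None\<close> plays the role of \<open>\<top>\<close>.\<close>
fun eqout :: "bool list \<times> bool list \<Rightarrow> bool list option" where
  "eqout (x, y) = (if x = y then Some x else None)"

end

theory Submission
  imports Defs
begin

text \<open>
  Upper bounds: a locally computed value becomes visible to an outside observer once Alice
  appends a \<open>k\<close>-bit encoding of her output, and EQout is solved locally by comparing two random
  hash bits, since on equal inputs either player already holds the output. Lower bound: for fixed
  coins the observer's output on \<open>(x, x)\<close> is a function of the transcript, so at most
  \<open>2 ^ (c + 1)\<close> of the \<open>2 ^ n\<close> diagonal inputs can be answered correctly; average over the coins.
\<close>

section \<open>Protocol trees\<close>

text \<open>Sequential composition of protocols. The continuation is indexed by the transcript of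
  the first phase, so the second phase may depend on everything said before.\<close>

primrec extend_tree ::
  "('x, 'y) ptree \<Rightarrow> (bool list \<Rightarrow> ('x, 'y) ptree) \<Rightarrow> ('x, 'y) ptree" where
  "extend_tree Leaf g = g []"
| "extend_tree (Alice s c) g = Alice s (\<lambda>i. extend_tree (c i) (\<lambda>t. g (i # t)))"
| "extend_tree (Bob s c) g = Bob s (\<lambda>i. extend_tree (c i) (\<lambda>t. g (i # t)))"

lemma run_extend_tree:
  "run (extend_tree T g) x a y b = run T x a y b @ run (g (run T x a y b)) x a y b"
  by (induction T arbitrary: g) auto

text \<open>Nodes hold functions of input and coins rather than bits, so the message is carried as a
  function \<open>w\<close> and peeled off pointwise.\<close>

primrec alice_speaks :: "nat \<Rightarrow> ('x \<Rightarrow> coins \<Rightarrow> bool list) \<Rightarrow> ('x, 'y) ptree" where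
  "alice_speaks 0 w = Leaf"
| "alice_speaks (Suc k) w = Alice (\<lambda>x a. hd (w x a)) (\<lambda>_. alice_speaks k (\<lambda>x a. tl (w x a)))"

lemma run_alice_speaks:
  "length (w x a) = k \<Longrightarrow> run (alice_speaks k w) x a y b = w x a"
  by (induction k arbitrary: w) (auto simp: length_Suc_conv)

section \<open>Cost\<close>

lemma length_transcript_le_cost:
  assumes "x \<in> X" "y \<in> Y" "(r, a, b) \<in> set_pmf (coin_dist \<pi>)"
  shows "enat (length (transcript \<pi> r a b x y)) \<le> cost X Y \<pi>"
  unfolding cost_def
  by (rule SUP_upper2[of "((x, y), (r, a, b))"]) (use assms in auto)

lemma cost_leI:
  assumes "\<And>x y r a b. x \<in> X \<Longrightarrow> y \<in> Y \<Longrightarrow> (r, a, b) \<in> set_pmf (coin_dist \<pi>) \<Longrightarrow>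
    enat (length (transcript \<pi> r a b x y)) \<le> c"
  shows "cost X Y \<pi> \<le> c"
  unfolding cost_def by (rule SUP_least) (use assms in auto)

text \<open>Extended naturals are well-ordered, so \<open>R_op\<close> and \<open>R_loc\<close> are
  realised by an actual protocol as soon as one exists.\<close>

lemma enat_INF_attained:
  fixes f :: "'a \<Rightarrow> enat"
  assumes "A \<noteq> {}"
  obtains x where "x \<in> A" "f x = (INF x\<in>A. f x)"
proof -
  have "(INF x\<in>A. f x) \<in> f ` A"
    using assms by (auto simp: Inf_enat_def intro: LeastI)
  then show ?thesis using that by auto
qed

section \<open>Comparison of the two models\<close>

lemma computes_local_if_computes_open:
  "computes_open \<epsilon> X Y f \<pi> \<Longrightarrow> computes_local \<epsilon> X Y f \<pi>"
  unfolding computes_open_def computes_local_def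
  by (elim exE, rule_tac x = "\<lambda>t r _ _. out t r" in exI, rule_tac x = "\<lambda>t r _ _. out t r" in exI)
    simp

lemma R_loc_le_R_op: "R_loc \<epsilon> X Y f \<le> R_op \<epsilon> X Y f"
  unfolding R_loc_def R_op_def
  by (rule INF_superset_mono) (auto intro: computes_local_if_computes_open)

lemma computes_open_extend_protocol:
  fixes f :: "'x \<times> 'y \<Rightarrow> 'z"
  assumes loc: "computes_local \<epsilon> X Y f \<pi>" and f: "f \<in> X \<times> Y \<rightarrow> Z"
    and enc: "\<And>z :: 'z. length (enc z :: bool list) = k" "inj_on enc Z"
  obtains \<pi>' where "computes_open \<epsilon> X Y f \<pi>'" "cost X Y \<pi>' \<le> cost X Y \<pi> + enat k"
proof -
  obtain outA outB where out: "\<And>x y. x \<in> X \<Longrightarrow> y \<in> Y \<Longrightarrow>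
      measure_pmf.prob (coin_dist \<pi>)
        {(r, a, b). outA (transcript \<pi> r a b x y) r a x = f (x, y) \<and>
                    outB (transcript \<pi> r a b x y) r b y = f (x, y)} \<ge> 1 - \<epsilon>"
    using loc unfolding computes_local_def by blast
  define \<pi>' where "\<pi>' = \<pi>\<lparr>tree := \<lambda>r. extend_tree (tree \<pi> r)
    (\<lambda>t. alice_speaks k (\<lambda>x a. enc (outA t r a x)))\<rparr>"
  have coins: "coin_dist \<pi>' = coin_dist \<pi>"
    by (simp add: \<pi>'_def coin_dist_def)
  have trans: "transcript \<pi>' r a b x y =
      transcript \<pi> r a b x y @ enc (outA (transcript \<pi> r a b x y) r a x)" for r a b x y
    by (simp add: \<pi>'_def transcript_def run_extend_tree run_alice_speaks enc(1))
  \<comment> \<open>The first phase may have varying length, so the code is located from the end of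
    the transcript.\<close>
  define out where "out = (\<lambda>t (_ :: coins). the_inv_into Z enc (drop (length t - k) t))"
  have "computes_open \<epsilon> X Y f \<pi>'"
    unfolding computes_open_def
  proof (intro exI[of _ out] ballI)
    fix x y assume xy: "x \<in> X" "y \<in> Y"
    have "f (x, y) \<in> Z" using f xy by auto
    \<comment> \<open>When both players are right, the appended block is the code of
      \<open>f (x, y)\<close>, and decoding inverts it because this value lies in
      \<open>Z\<close>.\<close>
    then have "{(r, a, b). outA (transcript \<pi> r a b x y) r a x = f (x, y) \<and>
                    outB (transcript \<pi> r a b x y) r b y = f (x, y)}
      \<subseteq> {(r, a, b). out (transcript \<pi>' r a b x y) r = f (x, y)}"
      by (auto simp: out_def trans enc the_inv_into_f_f)
    then show "1 - \<epsilon> \<le> measure_pmf.prob (coin_dist \<pi>')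
        {(r, a, b). out (transcript \<pi>' r a b x y) r = f (x, y)}"
      unfolding coins
      by (intro order_trans[OF out[OF xy]] measure_pmf.finite_measure_mono) auto
  qed
  moreover have "cost X Y \<pi>' \<le> cost X Y \<pi> + enat k"
  proof (rule cost_leI)
    fix x y r a b
    assume *: "x \<in> X" "y \<in> Y" "(r, a, b) \<in> set_pmf (coin_dist \<pi>')"
    have "enat (length (transcript \<pi>' r a b x y)) =
        enat (length (transcript \<pi> r a b x y)) + enat k"
      by (simp add: trans enc)
    also have "\<dots> \<le> cost X Y \<pi> + enat k"
      using * by (intro add_right_mono length_transcript_le_cost) (auto simp: coins)
    finally show "enat (length (transcript \<pi>' r a b x y)) \<le> cost X Y \<pi> + enat k" .
  qed
  ultimately show ?thesis by (rule that)
qed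

section \<open>Fixed-length binary codes and the additive bound\<close>

lemma bitstrings_eq: "bitstrings n = {xs. set xs \<subseteq> UNIV \<and> length xs = n}"
  by (simp add: bitstrings_def)

lemma finite_bitstrings [simp]: "finite (bitstrings n)"
  unfolding bitstrings_eq by (rule finite_lists_length_eq) simp

lemma card_bitstrings [simp]: "card (bitstrings n) = 2 ^ n"
  unfolding bitstrings_eq by (subst card_lists_length_eq) simp_all

lemma fixed_length_encoding:
  assumes "finite Z" "card Z \<le> 2 ^ k"
  obtains enc :: "'z \<Rightarrow> bool list" where "\<And>z. length (enc z) = k" "inj_on enc Z"
proof -
  obtain e where e: "inj_on e Z" "e ` Z \<subseteq> bitstrings k"
    using card_le_inj[of Z "bitstrings k"] assms by auto
  \<comment> \<open>In an erroneous run Alice may hold a value outside \<open>Z\<close>; the padding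
    keeps her message at length \<open>k\<close> even then.\<close>
  define enc where "enc = (\<lambda>z. if z \<in> Z then e z else replicate k False)"
  have "length (enc z) = k" for z
    using e by (auto simp: enc_def bitstrings_def)
  moreover have "inj_on enc Z"
    using e(1) by (auto simp: enc_def inj_on_def)
  ultimately show ?thesis by (rule that)
qed

lemma le_power_nat_ceiling_log:
  "m \<le> 2 ^ nat \<lceil>log 2 (real m)\<rceil>"
proof (cases "m = 0")
  \<comment> \<open>The identity below fails for \<open>m = 0\<close>, where the claim is
    trivial.\<close>
  case False
  then have "real m = 2 powr log 2 (real m)" by simp
  also have "\<dots> \<le> 2 powr real (nat \<lceil>log 2 (real m)\<rceil>)"
    by (intro powr_mono) (auto intro: real_nat_ceiling_ge)
  also have "\<dots> = real (2 ^ nat \<lceil>log 2 (real m)\<rceil>)"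
    by (simp add: powr_realpow)
  finally show ?thesis by (simp only: of_nat_le_iff)
qed simp

lemma R_op_le_R_loc_plus:
  fixes f :: "'x \<times> 'y \<Rightarrow> 'z"
  assumes "finite Z" "f \<in> X \<times> Y \<rightarrow> Z"
  shows "R_op \<epsilon> X Y f \<le> R_loc \<epsilon> X Y f + enat (nat \<lceil>log 2 (real (card Z))\<rceil>)"
proof (cases "{\<pi>. computes_local \<epsilon> X Y f \<pi>} = {}")
  \<comment> \<open>An infimum over no protocols is \<infinity>, which makes the bound
    trivial.\<close>
  case True
  then show ?thesis by (simp add: R_loc_def top_enat_def)
next
  case False
  then obtain \<pi> where \<pi>: "computes_local \<epsilon> X Y f \<pi>" "cost X Y \<pi> = R_loc \<epsilon> X Y f"
    unfolding R_loc_def by (rule enat_INF_attained) auto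
  obtain enc :: "'z \<Rightarrow> bool list"
    where enc: "\<And>z. length (enc z) = nat \<lceil>log 2 (real (card Z))\<rceil>" "inj_on enc Z"
    using fixed_length_encoding[OF assms(1) le_power_nat_ceiling_log] by blast
  obtain \<pi>' where \<pi>': "computes_open \<epsilon> X Y f \<pi>'"
      "cost X Y \<pi>' \<le> cost X Y \<pi> + enat (nat \<lceil>log 2 (real (card Z))\<rceil>)"
    using computes_open_extend_protocol[OF \<pi>(1) assms(2) enc] by blast
  then show ?thesis
    unfolding \<pi>(2) by (auto simp: R_op_def intro: INF_lower2)
qed

section \<open>The hashing protocol\<close>

text \<open>Flipping bit \<open>i\<close> is an involution exchanging the strings that agree at
  \<open>i\<close> and \<open>j\<close> with those that do not, so each kind makes up half.\<close>

lemma prob_uniform_bits_agree: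
  assumes "i < m" "j < m" "i \<noteq> j"
  shows "measure_pmf.prob (pmf_of_set (bitstrings m)) {u. u ! i = u ! j} = 1 / 2"
proof -
  let ?U = "bitstrings m" and ?E = "{u. u ! i = u ! j}"
  have ne: "?U \<noteq> {}" by (metis card.empty card_bitstrings power_eq_0_iff zero_neq_numeral)
  have "bij_betw (\<lambda>u. u[i := \<not> u ! i]) (?U \<inter> ?E) (?U - ?E)"
    by (rule bij_betw_byWitness[where f' = "\<lambda>u. u[i := \<not> u ! i]"])
      (use assms in \<open>auto simp: bitstrings_def list_update_same_conv\<close>)
  then have "card (?U - ?E) = card (?U \<inter> ?E)"
    by (simp add: bij_betw_same_card)
  moreover have "card ?U = card (?U \<inter> ?E) + card (?U - ?E)"
    by (rule card_Int_Diff) simp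
  ultimately have "2 ^ m = 2 * card (?U \<inter> ?E)"
    by simp
  then have "real (2 ^ m) = real (2 * card (?U \<inter> ?E))"
    by (simp only:)
  then have "real (card (?U \<inter> ?E)) = 2 ^ m / 2"
    by simp
  then show ?thesis
    using ne by (simp add: measure_pmf_of_set)
qed

text \<open>The public string is read as the truth tables of two independent random Boolean
  functions on \<open>S\<close>, each of length \<open>m\<close>. Distinct elements collide under
  each with probability 1/2.\<close>

lemma two_bit_hash:
  assumes "finite S"
  shows "\<exists>(p :: coins pmf) (h :: coins \<Rightarrow> 'a \<Rightarrow> bool list). (\<forall>r x. length (h r x) = 2) \<and>
    (\<forall>x\<in>S. \<forall>y\<in>S. x \<noteq> y \<longrightarrow> measure_pmf.prob p {r. h r x = h r y} = 1 / 4)"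
proof -
  obtain idx and m :: nat where idx: "inj_on idx S" "idx ` S = {i. i < m}"
    using finite_imp_inj_to_nat_seg[OF assms] by blast
  define U where "U = pmf_of_set (bitstrings m)"
  have ne: "bitstrings m \<noteq> {}"
    by (metis card.empty card_bitstrings power_eq_0_iff zero_neq_numeral)
  have len: "length u = m" if "u \<in> set_pmf U" for u
    using that ne by (simp add: U_def bitstrings_def[symmetric]) (simp add: bitstrings_def)
  define p where "p = map_pmf (\<lambda>(u, v). u @ v) (pair_pmf U U)"
  define h :: "coins \<Rightarrow> 'a \<Rightarrow> bool list"
    where "h = (\<lambda>r x. [r ! idx x, r ! (m + idx x)])"
  show ?thesis
  proof (intro exI[of _ p] exI[of _ h] conjI allI ballI impI)
    show "length (h r x) = 2" for r x by (simp add: h_def)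
  next
    fix x y assume xy: "x \<in> S" "y \<in> S" "x \<noteq> y"
    let ?E = "{u. u ! idx x = u ! idx y}"
    have i: "idx x < m" "idx y < m" "idx x \<noteq> idx y"
      using idx xy by (auto simp: inj_on_def)
    have "measure_pmf.prob p {r. h r x = h r y} = measure_pmf.prob (pair_pmf U U)
        {(u, v). h (u @ v) x = h (u @ v) y}"
      by (simp add: p_def vimage_def case_prod_unfold)
    \<comment> \<open>The two events agree only on the support, where \<open>u\<close> has length
      \<open>m\<close> and position \<open>m + idx x\<close> of \<open>u @ v\<close> is position
      \<open>idx x\<close> of \<open>v\<close>.\<close>
    also have "\<dots> = measure_pmf.prob (pair_pmf U U) (?E \<times> ?E)"
      by (rule measure_pmf.finite_measure_eq_AE)
        (auto simp: AE_measure_pmf_iff h_def nth_append len i)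
    also have "\<dots> = measure_pmf.prob U ?E * measure_pmf.prob U ?E"
      by (rule measure_pmf_prob_product) simp_all
    finally show "measure_pmf.prob p {r. h r x = h r y} = 1 / 4"
      by (simp add: U_def prob_uniform_bits_agree[OF i])
  qed
qed

text \<open>Alice sends her two hash bits and Bob replies whether they match his, three bits in all.
  Equal inputs never err; unequal ones err exactly on a collision.\<close>

lemma R_loc_eqout_le: "R_loc (1/4) (bitstrings n) (bitstrings n) eqout \<le> 3"
proof -
  obtain p :: "coins pmf" and h :: "coins \<Rightarrow> bool list \<Rightarrow> bool list"
    where h: "\<forall>r x. length (h r x) = 2"
    "\<forall>x\<in>bitstrings n. \<forall>y\<in>bitstrings n. x \<noteq> y \<longrightarrow>
      measure_pmf.prob p {r. h r x = h r y} = 1 / 4"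
    using two_bit_hash[OF finite_bitstrings[of n]] by blast
  define \<pi> :: "(bool list, bool list) protocol" where
    "\<pi> = \<lparr>public_coins = p, alice_coins = return_pmf [], bob_coins = return_pmf [],
      tree = \<lambda>r. extend_tree (alice_speaks 2 (\<lambda>x _. h r x))
        (\<lambda>t. Bob (\<lambda>y _. h r y = t) (\<lambda>_. Leaf))\<rparr>"
  have trans: "transcript \<pi> r a b x y = h r x @ [h r y = h r x]" for r a b x y
    by (simp add: \<pi>_def transcript_def run_extend_tree run_alice_speaks h)
  have public: "map_pmf fst (coin_dist \<pi>) = p"
    by (simp add: coin_dist_def map_fst_pair_pmf) (simp add: \<pi>_def)
  \<comment> \<open>One map serves both players: after a reported match each announces her or his
    own input.\<close>
  define outA :: "bool list \<Rightarrow> coins \<Rightarrow> coins \<Rightarrow> bool list \<Rightarrow> bool list option"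
    where "outA = (\<lambda>t r a x. if last t then Some x else None)"
  have "computes_local (1/4) (bitstrings n) (bitstrings n) eqout \<pi>"
    unfolding computes_local_def
  proof (intro exI[of _ outA] ballI)
    fix x y assume xy: "x \<in> bitstrings n" "y \<in> bitstrings n"
    let ?G = "{(r, a, b). outA (transcript \<pi> r a b x y) r a x = eqout (x, y) \<and>
                outA (transcript \<pi> r a b x y) r b y = eqout (x, y)}"
    show "1 - 1/4 \<le> measure_pmf.prob (coin_dist \<pi>) ?G"
    proof (cases "x = y")
      case True
      then have "?G = UNIV" by (auto simp: outA_def trans)
      then show ?thesis by simp
    next
      case False
      \<comment> \<open>Success depends on the public coins alone, so the probability can be
        computed under \<open>p\<close>.\<close>
      then have "?G = fst -` (- {r. h r x = h r y})"
        by (auto simp: outA_def trans)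
      then have "measure_pmf.prob (coin_dist \<pi>) ?G = measure_pmf.prob p (- {r. h r x = h r y})"
        by (simp add: public[symmetric])
      also have "\<dots> = 1 - 1/4"
        using measure_pmf.prob_compl[of "{r. h r x = h r y}" p] h(2) xy False
        by (simp add: Compl_eq_Diff_UNIV)
      finally show ?thesis by simp
    qed
  qed
  moreover have "cost (bitstrings n) (bitstrings n) \<pi> \<le> 3"
    by (rule cost_leI) (simp add: trans h numeral_eq_enat)
  ultimately show ?thesis
    by (auto simp: R_loc_def intro: INF_lower2)
qed

text \<open>Ensures that \<open>the_enat\<close> reads off a genuine number in the lower bound. The
  comparison of the models applies, as the codomain is finite.\<close>

lemma R_op_eqout_finite: "R_op (1/4) (bitstrings n) (bitstrings n) eqout \<noteq> \<infinity>"
proof -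
  let ?Z = "insert None (Some ` bitstrings n)"
  have "R_op (1/4) (bitstrings n) (bitstrings n) eqout
      \<le> R_loc (1/4) (bitstrings n) (bitstrings n) eqout
        + enat (nat \<lceil>log 2 (real (card ?Z))\<rceil>)"
    by (rule R_op_le_R_loc_plus) auto
  also have "\<dots> \<le> 3 + enat (nat \<lceil>log 2 (real (card ?Z))\<rceil>)"
    by (intro add_right_mono R_loc_eqout_le)
  finally show ?thesis by (auto simp: numeral_eq_enat dest: enat_ile)
qed

section \<open>The counting lower bound\<close>

text \<open>Double counting: by linearity the sum is the expected number of \<open>x\<close> whose
  event occurs, and this number is at most \<open>K\<close> at every outcome of the support.\<close>

lemma sum_prob_le_card_bound:
  assumes "finite S" "\<And>\<omega>. \<omega> \<in> set_pmf p \<Longrightarrow> card {x \<in> S. \<omega> \<in> A x} \<le> K"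
  shows "(\<Sum>x\<in>S. measure_pmf.prob p (A x)) \<le> real K"
proof -
  have int: "integrable (measure_pmf p) (indicat_real (A x))" for x
    by (rule measure_pmf.integrable_const_bound[where B = 1]) auto
  have "(\<Sum>x\<in>S. measure_pmf.prob p (A x)) =
      (\<Sum>x\<in>S. measure_pmf.expectation p (indicat_real (A x)))"
    by simp
  also have "\<dots> = measure_pmf.expectation p (\<lambda>\<omega>. \<Sum>x\<in>S. indicat_real (A x) \<omega>)"
    by (rule Bochner_Integration.integral_sum[symmetric]) (rule int)
  also have "\<dots> \<le> real K"
  proof (rule measure_pmf.integral_le_const)
    show "integrable (measure_pmf p) (\<lambda>\<omega>. \<Sum>x\<in>S. indicat_real (A x) \<omega>)"
      by (rule Bochner_Integration.integrable_sum) (rule int)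
    have "(\<Sum>x\<in>S. indicat_real (A x) \<omega>) = real (card {x \<in> S. \<omega> \<in> A x})" for \<omega>
      using assms(1) by (simp add: indicator_def sum.If_cases Int_def)
    then show "AE \<omega> in measure_pmf p. (\<Sum>x\<in>S. indicat_real (A x) \<omega>) \<le> real K"
      using assms(2) by (simp add: AE_measure_pmf_iff)
  qed
  finally show ?thesis .
qed

text \<open>Runs may stop early, so all lengths up to \<open>c\<close> are counted, by a geometric
  sum.\<close>

lemma card_bool_lists_length_le:
  "finite {t :: bool list. length t \<le> c}" "card {t :: bool list. length t \<le> c} \<le> 2 ^ (c + 1)"
proof -
  have eq: "{t :: bool list. length t \<le> c} = {t. set t \<subseteq> UNIV \<and> length t \<le> c}" by simp
  show "finite {t :: bool list. length t \<le> c}"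
    unfolding eq by (rule finite_lists_length_le) simp
  have "card {t :: bool list. length t \<le> c} = (\<Sum>i\<le>c. 2 ^ i)"
    unfolding eq by (subst card_lists_length_le) simp_all
  also have "\<dots> \<le> 2 ^ (c + 1)"
    by (induction c) auto
  finally show "card {t :: bool list. length t \<le> c} \<le> 2 ^ (c + 1)" .
qed

lemma cost_lower_bound_eqout:
  assumes "computes_open (1/4) (bitstrings n) (bitstrings n) eqout \<pi>"
    and cost: "cost (bitstrings n) (bitstrings n) \<pi> \<le> enat c"
  shows "n \<le> c + 1"
proof -
  obtain out where out: "\<And>x y. x \<in> bitstrings n \<Longrightarrow> y \<in> bitstrings n \<Longrightarrow>
      measure_pmf.prob (coin_dist \<pi>)
        {(r, a, b). out (transcript \<pi> r a b x y) r = eqout (x, y)} \<ge> 1 - 1/4"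
    using assms(1) unfolding computes_open_def by blast
  let ?A = "\<lambda>x. {(r, a, b). out (transcript \<pi> r a b x x) r = Some x}"
  have "(3/4) * 2 ^ n = (\<Sum>x\<in>bitstrings n. (3/4 :: real))"
    by simp
  also have "\<dots> \<le> (\<Sum>x\<in>bitstrings n. measure_pmf.prob (coin_dist \<pi>) (?A x))"
    by (rule sum_mono) (use out in force)
  also have "\<dots> \<le> real (2 ^ (c + 1))"
  proof (rule sum_prob_le_card_bound)
    fix \<omega> assume \<omega>: "\<omega> \<in> set_pmf (coin_dist \<pi>)"
    obtain r a b where [simp]: "\<omega> = (r, a, b)" by (cases \<omega>)
    let ?t = "\<lambda>x. transcript \<pi> r a b x x"
    let ?B = "{x \<in> bitstrings n. \<omega> \<in> ?A x}"
    \<comment> \<open>With the coins fixed, \<open>out\<close> recovers \<open>x\<close> from the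
      transcript of any correctly answered pair \<open>(x, x)\<close>.\<close>
    have "inj_on ?t ?B"
    proof (rule inj_onI)
      fix x y assume *: "x \<in> ?B" "y \<in> ?B" "?t x = ?t y"
      then have "Some x = out (?t x) r" "Some y = out (?t y) r" by auto
      with * show "x = y" by (metis option.inject)
    qed
    moreover have "?t ` ?B \<subseteq> {t. length t \<le> c}"
    proof -
      have "enat (length (?t x)) \<le> enat c" if "x \<in> bitstrings n" for x
        by (rule order_trans[OF length_transcript_le_cost[OF that that] cost]) (use \<omega> in simp)
      then show ?thesis by auto
    qed
    ultimately have "card ?B \<le> card {t :: bool list. length t \<le> c}"
      using card_bool_lists_length_le(1) by (rule card_inj_on_le)
    then show "card ?B \<le> 2 ^ (c + 1)"
      using card_bool_lists_length_le(2) by (rule order_trans)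
  qed simp
  finally have le: "(3/4) * 2 ^ n \<le> (2 :: real) ^ (c + 1)" by simp
  show ?thesis
  proof (rule ccontr)
    assume "\<not> n \<le> c + 1"
    \<comment> \<open>Otherwise \<open>2 ^ (c + 1)\<close> is at most half of \<open>2 ^ n\<close>,
      yet the success probability forces it to be at least three quarters.\<close>
    then have "(2 :: real) ^ (c + 2) \<le> 2 ^ n"
      by (intro power_increasing) auto
    moreover have "(2 :: real) ^ (c + 2) = 2 * 2 ^ (c + 1)" by simp
    moreover have "(0 :: real) < 2 ^ n" by simp
    ultimately show False using le by linarith
  qed
qed

lemma R_op_eqout_lower_bound:
  "n \<le> the_enat (R_op (1/4) (bitstrings n) (bitstrings n) eqout) + 1"
proof -
  have "{\<pi>. computes_open (1/4) (bitstrings n) (bitstrings n) eqout \<pi>} \<noteq> {}"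
  proof
    assume "{\<pi>. computes_open (1/4) (bitstrings n) (bitstrings n) eqout \<pi>} = {}"
    then show False
      using R_op_eqout_finite[of n] by (simp add: R_op_def top_enat_def)
  qed
  then obtain \<pi> where "computes_open (1/4) (bitstrings n) (bitstrings n) eqout \<pi>"
      "cost (bitstrings n) (bitstrings n) \<pi> = R_op (1/4) (bitstrings n) (bitstrings n) eqout"
    unfolding R_op_def by (rule enat_INF_attained) auto
  moreover have "R_op (1/4) (bitstrings n) (bitstrings n) eqout
      = enat (the_enat (R_op (1/4) (bitstrings n) (bitstrings n) eqout))"
    using R_op_eqout_finite[of n] by auto
  ultimately show ?thesis
    by (intro cost_lower_bound_eqout[of n \<pi>]) simp_all
qed

theorem mainTheorem8:
  "(\<forall>(X :: 'x set) (Y :: 'y set) (Z :: 'z set) (f :: 'x \<times> 'y \<Rightarrow> 'z) (\<epsilon> :: real).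
      finite Z \<and> f \<in> X \<times> Y \<rightarrow> Z \<and> \<epsilon> > 0 \<longrightarrow>
        R_loc \<epsilon> X Y f \<le> R_op \<epsilon> X Y f \<and>
        R_op \<epsilon> X Y f \<le> R_loc \<epsilon> X Y f + enat (nat \<lceil>log 2 (real (card Z))\<rceil>)) \<and>
   (\<forall>n. R_loc (1/4) (bitstrings n) (bitstrings n) eqout \<le> 4) \<and>
   (\<forall>n. R_op (1/4) (bitstrings n) (bitstrings n) eqout \<noteq> \<infinity>) \<and>
   (\<lambda>n. real (the_enat (R_op (1/4) (bitstrings n) (bitstrings n) eqout))) \<in> \<Omega>(\<lambda>n. real n)"
proof (intro conjI allI impI)
  fix X :: "'x set" and Y :: "'y set" and Z :: "'z set" and f :: "'x \<times> 'y \<Rightarrow> 'z" and \<epsilon> :: real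
  assume "finite Z \<and> f \<in> X \<times> Y \<rightarrow> Z \<and> \<epsilon> > 0"
  then show "R_op \<epsilon> X Y f \<le> R_loc \<epsilon> X Y f + enat (nat \<lceil>log 2 (real (card Z))\<rceil>)"
    by (intro R_op_le_R_loc_plus) simp_all
next
  fix n
  show "R_loc (1/4) (bitstrings n) (bitstrings n) eqout \<le> 4"
    by (rule order_trans[OF R_loc_eqout_le]) (simp add: numeral_eq_enat)
next
  let ?R = "\<lambda>n. the_enat (R_op (1/4) (bitstrings n) (bitstrings n) eqout)"
  show "(\<lambda>n. real (?R n)) \<in> \<Omega>(\<lambda>n. real n)"
  \<comment> \<open>The lower bound is \<open>n - 1\<close>, which is at least \<open>n / 2\<close>
    once \<open>n\<close> is at least 2.\<close>
  proof (rule landau_omega.bigI[of "1/2"])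
    show "\<forall>\<^sub>F n in sequentially. norm (real (?R n)) \<ge> 1/2 * norm (real n)"
      using eventually_ge_at_top[of 2]
    proof eventually_elim
      case (elim n)
      with R_op_eqout_lower_bound[of n] show ?case by simp
    qed
  qed simp
qed (rule R_loc_le_R_op R_op_eqout_finite)+

end
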